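(* Let $k$ be a field. A plane Cremona monomial map $F:\mathbb{P}^2\dashrightarrow\mathbb{P}^2$ over $k$ and its inverse have the same degree.
   Context: A tuple $(f_1,f_2,f_3)$ of forms of the same degree in $k[x_1,x_2,x_3]$, not all zero, defines a rational map $\mathbb{P}^2\dashrightarrow\mathbb{P}^2$; the tuples $(f_1,f_2,f_3)$ and $(gf_1,gf_2,gf_3)$, with $g$ a non-zero form, define the same rational map. A plane Cremona monomial map is a rational map $\mathbb{P}^2\dashrightarrow\mathbb{P}^2$ defined by three monomials (with coefficient $1$) of the same degree and admitting an inverse rational map $\mathbb{P}^2\dashrightarrow\mathbb{P}^2$; the inverse is again defined by monomials of a fixed degree. The degree of such a map is the common degree of its defining monomials when these are chosen without non-trivial common factor. *)

theory Defs
  imports Main "HOL-Library.Poly_Mapping" "HOL-Library.Numeral_Type"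
begin

(* Polynomials in three variables, indexed by the three-element type 3; a monomial is its
   exponent vector, and the product of finitely supported maps is the convolution product. *)
type_synonym mon3 = "3 \<Rightarrow>\<^sub>0 nat"
type_synonym 'k poly3 = "mon3 \<Rightarrow>\<^sub>0 'k"

definition mon_degree :: "mon3 \<Rightarrow> nat"
  where "mon_degree m = (\<Sum>i\<in>UNIV. Poly_Mapping.lookup m i)"

(* The zero polynomial is a form of every degree. *)
definition form :: "nat \<Rightarrow> 'k::field poly3 \<Rightarrow> bool"
  where "form d p \<longleftrightarrow> (\<forall>m\<in>Poly_Mapping.keys p. mon_degree m = d)"

definition form_tuple :: "(3 \<Rightarrow> 'k::field poly3) \<Rightarrow> bool"
  where "form_tuple f \<longleftrightarrow> (\<exists>d. \<forall>i. form d (f i)) \<and> (\<exists>i. f i \<noteq> 0)"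

(* The equivalence relation generated by identifying f with (g f) for non-zero forms g. *)
definition same_map :: "(3 \<Rightarrow> 'k::field poly3) \<Rightarrow> (3 \<Rightarrow> 'k poly3) \<Rightarrow> bool"
  where "same_map f f' \<longleftrightarrow> form_tuple f \<and> form_tuple f' \<and>
    (\<exists>g g'. (\<exists>d. form d g) \<and> (\<exists>d. form d g') \<and> g \<noteq> 0 \<and> g' \<noteq> 0 \<and> (\<forall>i. g * f i = g' * f' i))"

definition var :: "3 \<Rightarrow> 'k::field poly3"
  where "var i = Poly_Mapping.single (Poly_Mapping.single i 1) 1"

lemma mon_degree_add: "mon_degree (m + n) = mon_degree m + mon_degree n"
  by (simp add: mon_degree_def lookup_add sum.distrib)

lemma form_mult: "form d p \<Longrightarrow> form e q \<Longrightarrow> form (d + e) (p * q)"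
  unfolding form_def using keys_mult[of p q] by (fastforce simp: mon_degree_add)

lemma form_one: "form 0 (1 :: 'k::field poly3)"
  by (simp add: form_def mon_degree_def)

lemma form_tuple_var: "form_tuple (var :: 3 \<Rightarrow> 'k::field poly3)"
proof -
  have "form 1 (var i :: 'k poly3)" for i
    by (simp add: form_def var_def mon_degree_def lookup_single when_def)
  moreover have "(var 0 :: 'k poly3) \<noteq> 0"
    by (simp add: var_def flip: keys_eq_empty)
  ultimately show ?thesis
    unfolding form_tuple_def by blast
qed

lemma same_map_refl: "form_tuple f \<Longrightarrow> same_map f (f :: 3 \<Rightarrow> 'k::field poly3)"
  unfolding same_map_def
  by (intro conjI exI[of _ "1 :: 'k::field poly3"]) (auto intro: form_one)

lemma same_map_sym: "same_map f g \<Longrightarrow> same_map g f"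
  unfolding same_map_def by metis

lemma same_map_trans:
  assumes "same_map f g" "same_map g h"
  shows "same_map f h"
proof -
  obtain a b da db where ab: "form da a" "form db b" "a \<noteq> 0" "b \<noteq> 0" "\<And>i. a * f i = b * g i"
    using assms(1) unfolding same_map_def by blast
  obtain c e dc de where ce: "form dc c" "form de e" "c \<noteq> 0" "e \<noteq> 0" "\<And>i. c * g i = e * h i"
    using assms(2) unfolding same_map_def by blast
  have "c * a * f i = b * e * h i" for i
    using ab(5)[of i] ce(5)[of i] by (simp add: ac_simps) (metis mult.left_commute)
  moreover have "form (dc + da) (c * a)" "form (db + de) (b * e)" "c * a \<noteq> 0" "b * e \<noteq> 0"
    using ab ce by (auto intro: form_mult)
  ultimately show ?thesis
    using assms unfolding same_map_def by blast
qed

quotient_type (overloaded) 'k rat_map = "3 \<Rightarrow> 'k::field poly3" / partial: same_map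
proof (rule part_equivpI)
  show "\<exists>f :: 3 \<Rightarrow> 'k poly3. same_map f f"
    using form_tuple_var same_map_refl by blast
  show "symp (same_map :: (3 \<Rightarrow> 'k poly3) \<Rightarrow> _)"
    by (rule sympI) (rule same_map_sym)
  show "transp (same_map :: (3 \<Rightarrow> 'k poly3) \<Rightarrow> _)"
    by (rule transpI) (rule same_map_trans)
qed

definition defines_map :: "(3 \<Rightarrow> 'k::field poly3) \<Rightarrow> 'k rat_map \<Rightarrow> bool"
  where "defines_map f F \<longleftrightarrow> form_tuple f \<and> abs_rat_map f = F"

definition subst :: "'k::field poly3 \<Rightarrow> (3 \<Rightarrow> 'k poly3) \<Rightarrow> 'k poly3"
  where "subst p f = (\<Sum>m\<in>Poly_Mapping.keys p.
    Poly_Mapping.single 0 (Poly_Mapping.lookup p m) * (\<Prod>i\<in>UNIV. f i ^ Poly_Mapping.lookup m i))"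

(* H is the composite of G after F; no such H exists if G is undefined at the generic point
   of the image of F, since form_tuple excludes the zero tuple. *)
definition is_composite :: "'k::field rat_map \<Rightarrow> 'k rat_map \<Rightarrow> 'k rat_map \<Rightarrow> bool"
  where "is_composite G F H \<longleftrightarrow>
    (\<exists>g f. defines_map g G \<and> defines_map f F \<and> defines_map (\<lambda>i. subst (g i) f) H)"

definition id_map :: "'k::field rat_map"
  where "id_map = abs_rat_map var"

definition inverse_maps :: "'k::field rat_map \<Rightarrow> 'k rat_map \<Rightarrow> bool"
  where "inverse_maps F G \<longleftrightarrow> is_composite G F id_map \<and> is_composite F G id_map"

definition monomial_tuple :: "nat \<Rightarrow> (3 \<Rightarrow> 'k::field poly3) \<Rightarrow> bool"
  where "monomial_tuple d f \<longleftrightarrow> (\<forall>i. \<exists>m. mon_degree m = d \<and> f i = Poly_Mapping.single m 1)"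

definition cremona_monomial_map :: "'k::field rat_map \<Rightarrow> bool"
  where "cremona_monomial_map F \<longleftrightarrow>
    (\<exists>d f. monomial_tuple d f \<and> defines_map f F) \<and> (\<exists>G. inverse_maps F G)"

definition no_common_factor :: "(3 \<Rightarrow> 'k::field poly3) \<Rightarrow> bool"
  where "no_common_factor f \<longleftrightarrow> (\<forall>h. (\<forall>i. h dvd f i) \<longrightarrow> h dvd 1)"

(* Meaningful only for maps defined by monomials. *)
definition map_degree :: "'k::field rat_map \<Rightarrow> nat"
  where "map_degree F =
    (THE d. \<exists>f. monomial_tuple d f \<and> defines_map f F \<and> no_common_factor f)"

end

(*
  Let F be given by monomials with exponent rows a_1, a_2, a_3, and let g represent its inverse.
  Since g o F is the identity, each g_i(F) contains, up to a common monomial factor, the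
  monomial x_i; choosing a monomial of g_i that produces it gives a monomial tuple m with
  m o F the identity. As F is dominant, g and m define the same map.

  The degree of a monomial map depends only on the differences a_i - a_3, that is, on an
  integer 2x2 matrix X: once common factors are removed every column of exponents has minimum
  zero, so the degree is the mixed volume of the standard triangle and its image under X.
  Inverse maps have inverse matrices, and |det X| = 1, so the claim is the symmetry of the mixed
  volume, MV(T, X T) = MV(adj X T, T), which is an identity between piecewise linear functions on
  the region det X > 0. When det X = -1, swap two rows first.
*)
theory Submission
  imports Defs "HOL-Analysis.Cartesian_Space"
begin

section \<open>Symmetry of the mixed volume under the adjugate\<close>

text \<open>If \<open>a\<close> and \<open>d\<close> have equal signs, the bounds make their
  absolute values smaller than those of \<open>b\<close> and \<open>c\<close>, in one order or the
  other. If the signs differ, \<open>a * d\<close> is at most 0, whereas \<open>b * c\<close> is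
  positive.\<close>

lemma mult_less_of_abs_bounds:
  fixes a b c d :: int
  assumes "b < 0" "c < 0" "c < a" "a < - b" "b < d" "d < - c"
  shows "a * d < b * c"
proof -
  consider "a \<ge> 0" "d \<ge> 0" | "a \<le> 0" "d \<le> 0" | "a \<ge> 0" "d \<le> 0" | "a \<le> 0" "d \<ge> 0" by linarith
  then show ?thesis
  proof cases
    case 1
    then have "a * d < (- b) * (- c)" using assms by (intro mult_strict_mono) auto
    then show ?thesis by simp
  next
    case 2
    then have "(- a) * (- d) < (- c) * (- b)" using assms by (intro mult_strict_mono) auto
    then show ?thesis by (simp add: mult.commute)
  qed (use assms mult_neg_neg[of b c] mult_nonneg_nonpos[of a d] mult_nonpos_nonneg[of a d] in linarith)+
qed

text \<open>The standard triangle has outer normals (1, 1), (-1, 0), (0, -1) and edges of lattice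
  length 1. Summing the support function of the triangle 0, \<open>(a, b)\<close>,
  \<open>(c, d)\<close> over these normals gives the left side, a mixed volume; the right side is
  the same expression for the adjugate matrix.\<close>

lemma mixed_volume_le:
  fixes a b c d :: int
  assumes "a * d - b * c > 0"
  shows "max 0 (max (a + b) (c + d)) + max 0 (max (- a) (- c)) + max 0 (max (- b) (- d))
    \<le> max 0 (max (d - b) (a - c)) + max 0 (max (- d) c) + max 0 (max b (- a))"
proof -
  define p q r where "p = max 0 (max (d - b) (a - c))" and "q = max 0 (max (- d) c)"
    and "r = max 0 (max b (- a))"
  have le: "0 \<le> p" "d - b \<le> p" "a - c \<le> p" "0 \<le> q" "- d \<le> q" "c \<le> q" "0 \<le> r" "b \<le> r" "- a \<le> r"
    by (simp_all add: p_def q_def r_def)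
  (* Of the 27 choices of summands on the left, only these three need the determinant; rotating
     the vertices 0, (a, b), (c, d) of the triangle permutes them. *)
  have "- b - c \<le> p + q + r"
  proof (rule ccontr)
    assume "\<not> - b - c \<le> p + q + r"
    then have "a * d < b * c"
      using le by (intro mult_less_of_abs_bounds) linarith+
    then show False
      using assms by simp
  qed
  moreover have "a + b - d \<le> p + q + r"
  proof (rule ccontr)
    assume "\<not> a + b - d \<le> p + q + r"
    \<comment> \<open>Subtracting \<open>a * b\<close> from both sides leaves
      \<open>a * d < b * c\<close>.\<close>
    then have "(c - a) * (- b) < (d - b) * (- a)"
      using le by (intro mult_less_of_abs_bounds) linarith+
    then show False
      using assms by (simp add: algebra_simps)
  qed
  moreover have "c + d - a \<le> p + q + r"
  proof (rule ccontr)
    assume "\<not> c + d - a \<le> p + q + r"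
    then have "(- c) * (b - d) < (- d) * (a - c)"
      using le by (intro mult_less_of_abs_bounds) linarith+
    then show False
      using assms by (simp add: algebra_simps)
  qed
  ultimately have "max 0 (max (a + b) (c + d)) + max 0 (max (- a) (- c)) + max 0 (max (- b) (- d))
      \<le> p + q + r"
    unfolding max_add_distrib_left max_add_distrib_right max.bounded_iff
    using le by (intro conjI) linarith+
  then show ?thesis
    by (simp only: p_def q_def r_def)
qed

lemma mixed_volume_symmetric:
  fixes a b c d :: int
  assumes "a * d - b * c > 0"
  shows "max 0 (max (a + b) (c + d)) + max 0 (max (- a) (- c)) + max 0 (max (- b) (- d))
    = max 0 (max (d - b) (a - c)) + max 0 (max (- d) c) + max 0 (max b (- a))"
proof (rule antisym)
  \<comment> \<open>The adjugate has the same determinant and its own adjugate is the original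
    matrix, so the inequality for it is the converse one.\<close>
  have "d * a - (- b) * (- c) > 0"
    using assms by (simp add: mult.commute)
  from mixed_volume_le[OF this]
  show "max 0 (max (d - b) (a - c)) + max 0 (max (- d) c) + max 0 (max b (- a))
    \<le> max 0 (max (a + b) (c + d)) + max 0 (max (- a) (- c)) + max 0 (max (- b) (- d))"
    by (simp only: diff_minus_eq_add minus_minus add_uminus_conv_diff uminus_add_conv_diff add.commute[of d c])
qed (rule mixed_volume_le[OF assms])

section \<open>Coefficients of products and divisors of monomials\<close>

lemma poly_mapping_expansion:
  "(\<Sum>m\<in>Poly_Mapping.keys p. Poly_Mapping.single m (Poly_Mapping.lookup p m)) = p"
  by (rule poly_mapping_eqI)
    (auto simp: lookup_sum lookup_single when_def in_keys_iff sum.delta)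

lemma poly_mapping_single_induct [case_names zero single add]:
  fixes p :: "'a \<Rightarrow>\<^sub>0 'b::comm_monoid_add"
  assumes "P 0" "\<And>m c. P (Poly_Mapping.single m c)" "\<And>p q. P p \<Longrightarrow> P q \<Longrightarrow> P (p + q)"
  shows "P p"
proof -
  have "P (\<Sum>m\<in>S. Poly_Mapping.single m (Poly_Mapping.lookup p m))" if "finite S" for S
    using that by (induction S rule: finite_induct) (use assms in auto)
  from this[of "Poly_Mapping.keys p"] show ?thesis
    by (simp add: poly_mapping_expansion)
qed

text \<open>Among the pairs of support elements that contribute to this coefficient, at most
  \<open>(k, l)\<close> is left; if it is not such a pair, both sides vanish.\<close>

lemma lookup_mult_unique:
  fixes p q :: "'a::monoid_add \<Rightarrow>\<^sub>0 'b::semiring_0"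
  assumes "\<And>a b. a \<in> Poly_Mapping.keys p \<Longrightarrow> b \<in> Poly_Mapping.keys q \<Longrightarrow> a + b = k + l \<Longrightarrow> a = k \<and> b = l"
  shows "Poly_Mapping.lookup (p * q) (k + l) = Poly_Mapping.lookup p k * Poly_Mapping.lookup q l"
proof -
  have "p * q = (\<Sum>a\<in>Poly_Mapping.keys p. \<Sum>b\<in>Poly_Mapping.keys q.
      Poly_Mapping.single (a + b) (Poly_Mapping.lookup p a * Poly_Mapping.lookup q b))"
    by (subst (1 2) poly_mapping_expansion[symmetric])
      (simp only: sum_product mult_single)
  then have "Poly_Mapping.lookup (p * q) (k + l) =
      (\<Sum>a\<in>Poly_Mapping.keys p. \<Sum>b\<in>Poly_Mapping.keys q.
        Poly_Mapping.lookup p a * Poly_Mapping.lookup q b when a + b = k + l)"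
    by (simp add: lookup_sum lookup_single)
  also have "\<dots> = (\<Sum>a\<in>Poly_Mapping.keys p. \<Sum>b\<in>Poly_Mapping.keys q.
        if a = k then if b = l then Poly_Mapping.lookup p k * Poly_Mapping.lookup q l else 0 else 0)"
    using assms by (intro sum.cong refl) (auto simp: when_def)
  also have "\<dots> = (\<Sum>a\<in>Poly_Mapping.keys p. if a = k then
        if l \<in> Poly_Mapping.keys q then Poly_Mapping.lookup p k * Poly_Mapping.lookup q l else 0 else 0)"
    by (intro sum.cong refl) simp
  also have "\<dots> = Poly_Mapping.lookup p k * Poly_Mapping.lookup q l"
    by (auto simp: in_keys_iff)
  finally show ?thesis .
qed

lemma lookup_mult_single:
  fixes p :: "'a::cancel_comm_monoid_add \<Rightarrow>\<^sub>0 'b::semiring_0"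
  shows "Poly_Mapping.lookup (p * Poly_Mapping.single a c) (k + a) = Poly_Mapping.lookup p k * c"
  by (subst lookup_mult_unique) (auto split: if_splits)

text \<open>The largest exponents of the two factors have a sum that arises in only one way, so its
  coefficient cannot cancel; the same holds for the smallest exponents. Both sums must be
  \<open>m\<close>, which forces the largest and smallest exponents of \<open>h\<close> to
  coincide.\<close>

lemma divisor_of_single:
  fixes h q :: "'a::{ordered_cancel_comm_monoid_add, linorder} \<Rightarrow>\<^sub>0 'b::{semiring_no_zero_divisors}"
  assumes "h * q = Poly_Mapping.single m c" "c \<noteq> 0"
  obtains k l e where "h = Poly_Mapping.single k e" "k + l = m"
proof -
  let ?K = "Poly_Mapping.keys h" and ?L = "Poly_Mapping.keys q"
  have ne: "?K \<noteq> {}" "?L \<noteq> {}"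
    using assms by (auto simp: keys_eq_empty dest!: arg_cong[of _ _ "\<lambda>p. Poly_Mapping.lookup p m"])
  have fin: "finite ?K" "finite ?L"
    by simp_all
  have unique: "k + l = m" if "k \<in> ?K" "l \<in> ?L"
    "\<And>a b. a \<in> ?K \<Longrightarrow> b \<in> ?L \<Longrightarrow> a + b = k + l \<Longrightarrow> a = k \<and> b = l" for k l
  proof -
    have "Poly_Mapping.lookup (h * q) (k + l) \<noteq> 0"
      using that by (subst lookup_mult_unique) (auto simp: in_keys_iff)
    then show ?thesis
      using assms by (auto simp: lookup_single when_def split: if_splits)
  qed
  have max: "Max ?K + Max ?L = m"
  proof (rule unique)
    fix a b assume "a \<in> ?K" "b \<in> ?L" and eq: "a + b = Max ?K + Max ?L"
    then have "a \<le> Max ?K" "b \<le> Max ?L"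
      using fin by auto
    then show "a = Max ?K \<and> b = Max ?L"
      using eq add_less_le_mono[of a "Max ?K" b "Max ?L"] add_le_less_mono[of a "Max ?K" b "Max ?L"]
      by (auto simp: order_le_less)
  qed (use fin ne in auto)
  have min: "Min ?K + Min ?L = m"
  proof (rule unique)
    fix a b assume "a \<in> ?K" "b \<in> ?L" and eq: "a + b = Min ?K + Min ?L"
    then have "Min ?K \<le> a" "Min ?L \<le> b"
      using fin by auto
    then show "a = Min ?K \<and> b = Min ?L"
      using eq add_less_le_mono[of "Min ?K" a "Min ?L" b] add_le_less_mono[of "Min ?K" a "Min ?L" b]
      by (auto simp: order_le_less)
  qed (use fin ne in auto)
  have le: "Min ?K \<le> Max ?K" "Min ?L \<le> Max ?L"
    using fin ne by auto
  have "Min ?K = Max ?K"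
    using max min le add_less_le_mono[of "Min ?K" "Max ?K" "Min ?L" "Max ?L"]
    by (auto simp: order_le_less)
  then have "?K \<subseteq> {Max ?K}"
    using fin by (metis Max_ge Min_le antisym singletonI subsetI)
  then have "h = Poly_Mapping.single (Max ?K) (Poly_Mapping.lookup h (Max ?K))"
    by (intro poly_mapping_eqI) (auto simp: lookup_single when_def in_keys_iff)
  then show ?thesis
    using that max by blast
qed

section \<open>Substitution and its effect on exponents\<close>

abbreviation monomial :: "mon3 \<Rightarrow> 'k::field poly3"
  where "monomial m \<equiv> Poly_Mapping.single m 1"

(* Multiples are iterated sums: since 3 is a monoid, n * A l would be a convolution of exponent
   vectors, and the simp rule sum_constant, which rewrites to it, must be disabled. *)
definition mon_subst :: "mon3 \<Rightarrow> (3 \<Rightarrow> mon3) \<Rightarrow> mon3"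
  where "mon_subst m A = (\<Sum>l\<in>UNIV. \<Sum>_<Poly_Mapping.lookup m l. A l)"

lemma lookup_mon_subst:
  "Poly_Mapping.lookup (mon_subst m A) j =
    (\<Sum>l\<in>UNIV. Poly_Mapping.lookup m l * Poly_Mapping.lookup (A l) j)"
  by (simp add: mon_subst_def lookup_sum del: sum_constant) simp

lemma monomial_power: "monomial a ^ n = (monomial (\<Sum>_<n. a) :: 'k::field poly3)"
  by (induction n) (simp_all add: mult_single add.commute del: sum_constant)

lemma monomial_prod: "(\<Prod>i\<in>S. monomial (a i)) = (monomial (\<Sum>i\<in>S. a i) :: 'k::field poly3)"
  by (induction S rule: infinite_finite_induct) (simp_all add: mult_single)

lemma prod_monomial_power:
  "(\<Prod>i\<in>UNIV. monomial (A i) ^ Poly_Mapping.lookup m i) = (monomial (mon_subst m A) :: 'k::field poly3)"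
  by (simp add: monomial_power monomial_prod mon_subst_def)

lemma mon_subst_unit: "mon_subst m (\<lambda>i. Poly_Mapping.single i 1) = m"
  by (rule poly_mapping_eqI) (simp add: lookup_mon_subst lookup_single when_def if_distrib cong: if_cong)

lemma subst_superset:
  assumes "finite S" "Poly_Mapping.keys p \<subseteq> S"
  shows "subst p f = (\<Sum>m\<in>S.
    Poly_Mapping.single 0 (Poly_Mapping.lookup p m) * (\<Prod>i\<in>UNIV. f i ^ Poly_Mapping.lookup m i))"
  unfolding subst_def using assms by (intro sum.mono_neutral_left) (auto simp: in_keys_iff)

lemma subst_0 [simp]: "subst 0 f = 0"
  by (simp add: subst_def)

lemma subst_add: "subst (p + q) f = subst p f + subst q f"
proof -
  let ?S = "Poly_Mapping.keys p \<union> Poly_Mapping.keys q"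
  have "Poly_Mapping.keys (p + q) \<subseteq> ?S"
    by (rule keys_add)
  then show ?thesis
    by (simp add: subst_superset[of ?S] lookup_add single_add distrib_right sum.distrib)
qed

lemma subst_diff: "subst (p - q) f = subst p f - subst q f"
  by (metis subst_add add_diff_cancel_right' diff_add_cancel)

lemma subst_single:
  "subst (Poly_Mapping.single m c) f =
    Poly_Mapping.single 0 c * (\<Prod>i\<in>UNIV. f i ^ Poly_Mapping.lookup m i)"
  by (subst subst_superset[of "{m}"]) simp_all

lemma subst_const: "subst (Poly_Mapping.single 0 c) f = Poly_Mapping.single 0 c"
  by (simp add: subst_single)

lemma subst_mult: "subst (p * q) f = subst p f * subst q f"
proof (induction p rule: poly_mapping_single_induct)
  case (single m c)
  show ?case
  proof (induction q rule: poly_mapping_single_induct)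
    case (single n e)
    have "Poly_Mapping.single (0::mon3) (c * e) = Poly_Mapping.single 0 c * Poly_Mapping.single 0 e"
      by (simp add: mult_single)
    then show ?case
      by (simp add: mult_single subst_single lookup_add power_add prod.distrib ac_simps)
  qed (simp_all add: subst_add distrib_left)
qed (simp_all add: subst_add distrib_right)

lemma subst_1 [simp]: "subst 1 f = 1"
  using subst_const[of 1 f] by simp

lemma subst_power: "subst (p ^ n) f = subst p f ^ n"
  by (induction n) (simp_all add: subst_mult)

lemma subst_prod: "subst (\<Prod>i\<in>S. p i) f = (\<Prod>i\<in>S. subst (p i) f)"
  by (induction S rule: infinite_finite_induct) (simp_all add: subst_mult)

lemma subst_subst: "subst (subst p f) g = subst p (\<lambda>i. subst (f i) g)"
  by (induction p rule: poly_mapping_single_induct)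
    (simp_all add: subst_add subst_single subst_mult subst_prod subst_power subst_const)

lemma subst_var: "subst p var = p"
  unfolding subst_def var_def prod_monomial_power mon_subst_unit
  by (simp add: mult_single poly_mapping_expansion)

lemma subst_scale:
  assumes "form D p"
  shows "subst p (\<lambda>i. c * f i) = c ^ D * subst p f"
proof -
  have "(\<Prod>i\<in>UNIV. (c * f i) ^ Poly_Mapping.lookup m i) = c ^ D * (\<Prod>i\<in>UNIV. f i ^ Poly_Mapping.lookup m i)"
    if "m \<in> Poly_Mapping.keys p" for m
    using assms that
    by (auto simp: form_def mon_degree_def power_mult_distrib prod.distrib power_sum)
  then show ?thesis
    by (auto simp: subst_def sum_distrib_left ac_simps intro!: sum.cong)
qed

lemma subst_monomials:
  "subst (monomial m) (\<lambda>i. monomial (A i)) = (monomial (mon_subst m A) :: 'k::field poly3)"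
  by (simp add: subst_single prod_monomial_power)

text \<open>Different exponents of \<open>p\<close> may have the same image and cancel, so only one
  inclusion of supports is asserted.\<close>

lemma keys_subst_monomials:
  fixes p :: "'k::field poly3"
  assumes "n \<in> Poly_Mapping.keys (subst p (\<lambda>i. monomial (A i)))"
  obtains m where "m \<in> Poly_Mapping.keys p" "n = mon_subst m A"
proof -
  have eq: "subst p (\<lambda>i. monomial (A i)) =
      (\<Sum>m\<in>Poly_Mapping.keys p. Poly_Mapping.single (mon_subst m A) (Poly_Mapping.lookup p m))"
    unfolding subst_def prod_monomial_power by (simp add: mult_single)
  have "n \<in> (\<Union>m\<in>Poly_Mapping.keys p.
      Poly_Mapping.keys (Poly_Mapping.single (mon_subst m A) (Poly_Mapping.lookup p m)))"
    by (rule subsetD[OF keys_sum assms[unfolded eq]])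
  then show ?thesis
    using that by (auto split: if_splits)
qed

lemma form_diff: "form d p \<Longrightarrow> form d q \<Longrightarrow> form d (p - q :: 'k::field poly3)"
  unfolding form_def by (auto simp: in_keys_iff lookup_minus)

section \<open>Proportional tuples, composition and dominance\<close>

text \<open>The 2x2 minors of the rows \<open>f\<close> and \<open>f'\<close> vanish: a form of
  \<open>same_map\<close> without auxiliary multipliers. The zero tuple is proportional to
  everything, so \<open>form_tuple\<close> has to accompany this condition.\<close>

definition proportional :: "(3 \<Rightarrow> 'k::field poly3) \<Rightarrow> (3 \<Rightarrow> 'k poly3) \<Rightarrow> bool"
  where "proportional f f' \<longleftrightarrow> (\<forall>i j. f i * f' j = f j * f' i)"

lemma proportionalD: "proportional f f' \<Longrightarrow> f i * f' j = f j * f' i"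
  by (simp add: proportional_def)

lemma same_map_iff_proportional:
  "same_map f f' \<longleftrightarrow> form_tuple f \<and> form_tuple f' \<and> proportional f f'"
proof (intro iffI conjI)
  assume "same_map f f'"
  then obtain g g' where gg: "g \<noteq> 0" "g' \<noteq> 0" "\<And>i. g * f i = g' * f' i"
    unfolding same_map_def by blast
  show "proportional f f'"
    unfolding proportional_def
  proof (intro allI)
    fix i j
    have "(g * g') * (f i * f' j) = (g * f i) * (g' * f' j)"
      by (simp add: ac_simps)
    also have "\<dots> = (g' * f' i) * (g * f j)"
      by (simp add: gg(3))
    also have "\<dots> = (g * g') * (f j * f' i)"
      by (simp add: ac_simps)
    finally show "f i * f' j = f j * f' i"
      using gg by (simp only: mult_cancel_left) simp
  qed
next
  assume *: "form_tuple f \<and> form_tuple f' \<and> proportional f f'"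
  then obtain i k where ik: "f i \<noteq> 0" "f' k \<noteq> 0"
    unfolding form_tuple_def by blast
  \<comment> \<open>The multipliers will be \<open>f' i\<close> and \<open>f i\<close>; the minor
    for \<open>i\<close> and \<open>k\<close> shows that the former is non-zero.\<close>
  then have "f k * f' i \<noteq> 0"
    using proportionalD[of f f' i k] * by (metis mult_eq_0_iff)
  then have "f' i \<noteq> 0"
    by auto
  moreover have "f' i * f l = f i * f' l" for l
    using proportionalD[of f f' i l] * by (simp only: mult.commute[of "f' i"])
  moreover have "\<exists>d. form d (f' i)" "\<exists>d. form d (f i)"
    using * unfolding form_tuple_def by blast+
  ultimately show "same_map f f'"
    unfolding same_map_def using * ik by blast
qed (auto simp: same_map_def)

lemma defines_map_iff_proportional:
  assumes "defines_map f F"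
  shows "defines_map f' F \<longleftrightarrow> form_tuple f' \<and> proportional f f'"
proof -
  have "same_map f f' \<longleftrightarrow> same_map f f \<and> same_map f' f' \<and> abs_rat_map f = abs_rat_map f'"
    using Quotient3_rel[OF Quotient3_rat_map, of f f'] by blast
  then show ?thesis
    using assms same_map_refl same_map_iff_proportional unfolding defines_map_def by metis
qed

text \<open>Scaling \<open>f'\<close> by \<open>f i\<close> and \<open>f\<close> by
  \<open>f' i\<close> gives the same tuple, and a form of degree \<open>D\<close> pulls out the
  \<open>D\<close>-th power of the scalar.\<close>

lemma subst_proportional:
  assumes "proportional f f'" "form D p"
  shows "f i ^ D * subst p f' = f' i ^ D * subst p f"
proof -
  have "(\<lambda>j. f i * f' j) = (\<lambda>j. f' i * f j)"
    using assms(1) by (auto simp: proportional_def mult.commute)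
  then show ?thesis
    using subst_scale[OF assms(2)] by metis
qed

lemma subst_proportional_eq_0:
  assumes "proportional f f'" "form D p" "form_tuple f" "subst p f = 0"
  shows "subst p f' = 0"
proof -
  obtain i where "f i \<noteq> 0"
    using assms(3) unfolding form_tuple_def by blast
  then show ?thesis
    using subst_proportional[OF assms(1,2), of i] assms(4) by simp
qed

lemma composite_eq_id_map:
  assumes "is_composite G F id_map"
  obtains g f where "defines_map g G" "defines_map f F" "form_tuple (\<lambda>i. subst (g i) f)"
    "proportional (\<lambda>i. subst (g i) f) var"
proof -
  obtain g f where gf: "defines_map g G" "defines_map f F" "defines_map (\<lambda>i. subst (g i) f) id_map"
    using assms unfolding is_composite_def by blast
  moreover have "defines_map var (id_map :: 'a rat_map)"
    by (simp add: defines_map_def id_map_def form_tuple_var)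
  ultimately show ?thesis
    using that defines_map_iff_proportional[OF gf(3)] by (auto simp: defines_map_def)
qed

text \<open>A form that vanishes on the image of F also vanishes on the composite of F after G. That
  composite is proportional to the variables, and substituting the variables returns the form
  itself.\<close>

lemma right_invertible_imp_dominant:
  assumes "is_composite F G id_map" "defines_map f F" "form D p" "subst p f = 0"
  shows "p = 0"
proof -
  obtain f' g where fg: "defines_map f' F" "form_tuple (\<lambda>i. subst (f' i) g)"
      "proportional (\<lambda>i. subst (f' i) g) var"
    using composite_eq_id_map[OF assms(1)] by metis
  have "proportional f f'" "form_tuple f"
    using assms(2) fg(1) defines_map_iff_proportional by (blast, simp add: defines_map_def)
  then have "subst p f' = 0"
    using subst_proportional_eq_0 assms(3,4) by blast
  then have "subst p (\<lambda>i. subst (f' i) g) = 0"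
    using subst_subst[of p f' g] by simp
  then show ?thesis
    using subst_proportional_eq_0[OF fg(3) assms(3) fg(2)] by (simp add: subst_var)
qed

text \<open>\<open>is_composite\<close> speaks of some representatives only; this passes to
  arbitrary ones, first from \<open>f'\<close> to \<open>f\<close>, then from \<open>g'\<close> to
  \<open>g\<close>.\<close>

lemma composite_eq_id_map_proportional:
  assumes "is_composite G F id_map" "defines_map g G" "defines_map f F"
  shows "proportional (\<lambda>i. subst (g i) f) var"
proof -
  obtain g' f' where g'f': "defines_map g' G" "defines_map f' F"
      "form_tuple (\<lambda>i. subst (g' i) f')" "proportional (\<lambda>i. subst (g' i) f') var"
    using composite_eq_id_map[OF assms(1)] by metis
  have ff': "proportional f' f" and gg': "proportional g g'"
    using assms g'f' defines_map_iff_proportional by blast+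
  obtain D where D: "\<And>i. form D (g' i)"
    using g'f' unfolding defines_map_def form_tuple_def by blast
  obtain i0 where i0: "f i0 \<noteq> 0"
    using assms(3) unfolding defines_map_def form_tuple_def by blast
  obtain l where "subst (g' l) f' \<noteq> 0"
    using g'f'(3) unfolding form_tuple_def by blast
  \<comment> \<open>This non-zero component is the factor cancelled at the end, when
    \<open>g'\<close> is exchanged for \<open>g\<close>.\<close>
  then have l: "subst (g' l) f \<noteq> 0"
    using subst_proportional[OF ff' D, of i0 l] i0 by auto
  have g'f: "f' i0 ^ D * subst (g' k) f = f i0 ^ D * subst (g' k) f'" for k
    by (rule subst_proportional[OF ff' D])
  have "f' i0 \<noteq> 0"
  proof
    assume "f' i0 = 0"
    moreover obtain j where "f' j \<noteq> 0"
      using g'f'(2) unfolding defines_map_def form_tuple_def by blast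
    ultimately show False
      using proportionalD[OF ff', of i0 j] i0 by simp
  qed
  \<comment> \<open>Here \<open>f\<close> has replaced \<open>f'\<close> while \<open>g'\<close> is
    still in place; a power of \<open>f' i0\<close> is cancelled.\<close>
  have cross: "subst (g' i) f * var j = subst (g' j) f * var i" for i j
  proof -
    have "f' i0 ^ D * (subst (g' i) f * var j) = f i0 ^ D * (subst (g' i) f' * var j)"
      by (simp only: g'f mult.assoc[symmetric])
    also have "\<dots> = f i0 ^ D * (subst (g' j) f' * var i)"
      using proportionalD[OF g'f'(4), of i j] by simp
    also have "\<dots> = f' i0 ^ D * (subst (g' j) f * var i)"
      by (simp only: g'f mult.assoc[symmetric])
    finally show ?thesis
      using \<open>f' i0 \<noteq> 0\<close> by simp
  qed
  have gg'f: "subst (g i) f * subst (g' j) f = subst (g j) f * subst (g' i) f" for i j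
    using proportionalD[OF gg'] subst_mult by metis
  have swap: "subst (g' l) f * (subst (g k) f * v) = subst (g l) f * (subst (g' k) f * v)" for k v
    using arg_cong[OF gg'f[of k l], of "\<lambda>p. p * v"] by (simp only: ac_simps)
  show ?thesis
    unfolding proportional_def
  proof (intro allI)
    fix i j
    have "subst (g' l) f * (subst (g i) f * var j) = subst (g' l) f * (subst (g j) f * var i)"
      by (simp only: swap cross[of i j])
    then show "subst (g i) f * var j = subst (g j) f * var i"
      using l by simp
  qed
qed

section \<open>Monomial representatives of the inverse\<close>

lemma form_tuple_monomials:
  assumes "\<And>i. mon_degree (A i) = d"
  shows "form_tuple (\<lambda>i. monomial (A i) :: 'k::field poly3)"
  unfolding form_tuple_def form_def using assms by (auto simp flip: keys_eq_empty)

lemma monomial_eq_iff: "monomial a = (monomial b :: 'k::field poly3) \<longleftrightarrow> a = b"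
  by (metis keys_single one_neq_zero singleton_inject)

lemma proportional_monomials:
  "proportional (\<lambda>i. monomial (A i) :: 'k::field poly3) (\<lambda>i. monomial (B i)) \<longleftrightarrow>
    (\<forall>i j. A i + B j = A j + B i)"
  by (simp add: proportional_def mult_single monomial_eq_iff)

lemma inverse_map_monomial:
  fixes F G :: "'k::field rat_map"
  assumes "inverse_maps F G" and F: "defines_map (\<lambda>i. monomial (A i)) F"
  obtains B d where "\<And>i. mon_degree (B i) = d" "defines_map (\<lambda>i. monomial (B i)) G"
proof -
  let ?f = "\<lambda>i. monomial (A i) :: 'k poly3"
  have comp: "is_composite G F id_map" "is_composite F G id_map"
    using assms(1) by (simp_all add: inverse_maps_def)
  obtain g where g: "defines_map g G"
    using composite_eq_id_map[OF comp(1)] by metis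
  obtain d where d: "\<And>i. form d (g i)"
    using g unfolding defines_map_def form_tuple_def by blast
  obtain i0 where i0: "g i0 \<noteq> 0"
    using g unfolding defines_map_def form_tuple_def by blast
  have cross: "subst (g i) ?f * var j = subst (g j) ?f * var i" for i j
    using composite_eq_id_map_proportional[OF comp(1) g F] by (simp add: proportional_def)
  have "subst (g i0) ?f \<noteq> 0"
    using right_invertible_imp_dominant[OF comp(2) F d] i0 by blast
  then obtain n where n: "n \<in> Poly_Mapping.keys (subst (g i0) ?f)"
    by (auto simp flip: keys_eq_empty)
  \<comment> \<open>Multiplying by a variable shifts exponents without cancellation. So the exponent
    \<open>n\<close> of component \<open>i0\<close> yields, in every component \<open>i\<close>, the
    exponent obtained from \<open>n\<close> by trading one \<open>i0\<close> for one
    \<open>i\<close>; the equation avoids subtraction.\<close>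
  have "\<exists>m. m \<in> Poly_Mapping.keys (g i) \<and>
      mon_subst m A + Poly_Mapping.single i0 1 = n + Poly_Mapping.single i 1" for i
  proof -
    have "n + Poly_Mapping.single i 1 \<in> Poly_Mapping.keys (subst (g i0) ?f * var i)"
      using n by (simp add: in_keys_iff var_def lookup_mult_single)
    then have "n + Poly_Mapping.single i 1 \<in> Poly_Mapping.keys (subst (g i) ?f * var i0)"
      by (simp only: cross[of i0 i])
    then obtain n' where "n' \<in> Poly_Mapping.keys (subst (g i) ?f)"
        "n + Poly_Mapping.single i 1 = n' + Poly_Mapping.single i0 1"
      using keys_mult[of "subst (g i) ?f" "var i0"] by (auto simp: var_def)
    then show ?thesis
      by (metis keys_subst_monomials)
  qed
  then obtain B where B: "\<And>i. B i \<in> Poly_Mapping.keys (g i)"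
      "\<And>i. mon_subst (B i) A + Poly_Mapping.single i0 1 = n + Poly_Mapping.single i 1"
    by metis
  let ?h = "\<lambda>i. monomial (B i) :: 'k poly3"
  have deg: "mon_degree (B i) = d" for i
    using B(1) d unfolding form_def by blast
  have h: "subst (?h j) ?f * var i0 = monomial n * var j" for j
    unfolding subst_monomials var_def using B(2)[of j] by (simp add: mult_single)
  \<comment> \<open>The minors of \<open>g\<close> and \<open>?h\<close> are forms of degree
    \<open>d + d\<close> that vanish after substituting \<open>?f\<close>, so dominance makes them
    zero.\<close>
  have "proportional g ?h"
    unfolding proportional_def
  proof (intro allI)
    fix i j
    have *: "subst (g i * ?h j) ?f * var i0 = monomial n * (subst (g i) ?f * var j)" for i j
      using h[of j] by (simp add: subst_mult mult.assoc mult.left_commute)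
    have "subst (g i * ?h j) ?f * var i0 = subst (g j * ?h i) ?f * var i0"
      by (simp only: * cross[of i j])
    moreover have "(var i0 :: 'k poly3) \<noteq> 0"
      by (simp add: var_def flip: keys_eq_empty)
    ultimately have "subst (g i * ?h j - g j * ?h i) ?f = 0"
      by (simp add: subst_diff)
    moreover have "form (d + d) (g i * ?h j - g j * ?h i)"
      using d deg by (intro form_diff form_mult) (auto simp: form_def)
    ultimately have "g i * ?h j - g j * ?h i = 0"
      using right_invertible_imp_dominant[OF comp(2) F] by blast
    then show "g i * ?h j = g j * ?h i"
      by simp
  qed
  then have "defines_map ?h G"
    using defines_map_iff_proportional[OF g] form_tuple_monomials deg by blast
  then show ?thesis
    using that deg by blast
qed

section \<open>Removing common factors and computing \<open>map_degree\<close>\<close>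

definition reduced :: "(3 \<Rightarrow> mon3) \<Rightarrow> bool"
  where "reduced A \<longleftrightarrow> (\<forall>j. \<exists>i. Poly_Mapping.lookup (A i) j = 0)"

lemma reduced_part:
  obtains R m where "reduced R" "\<And>i. A i = R i + m"
proof
  \<comment> \<open>The columnwise minimum is the exponent of the greatest common divisor of the
    three monomials.\<close>
  define m :: mon3 where "m = Abs_poly_mapping (\<lambda>j. Min (range (\<lambda>i. Poly_Mapping.lookup (A i) j)))"
  have m: "Poly_Mapping.lookup m j = Min (range (\<lambda>i. Poly_Mapping.lookup (A i) j))" for j
    by (simp add: m_def)
  have le: "Poly_Mapping.lookup m j \<le> Poly_Mapping.lookup (A i) j" for i j
    by (simp add: m)
  show "A i = (A i - m) + m" for i
    by (rule poly_mapping_eqI) (simp add: lookup_add minus_poly_mapping.rep_eq le)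
  show "reduced (\<lambda>i. A i - m)"
    unfolding reduced_def
  proof
    fix j
    have "Poly_Mapping.lookup m j \<in> range (\<lambda>i. Poly_Mapping.lookup (A i) j)"
      unfolding m by (rule Min_in) auto
    then obtain i where "Poly_Mapping.lookup m j = Poly_Mapping.lookup (A i) j"
      by blast
    then show "\<exists>i. Poly_Mapping.lookup (A i - m) j = 0"
      by (intro exI[of _ i]) (simp add: minus_poly_mapping.rep_eq)
  qed
qed

text \<open>A variable that divides all three monomials is a non-unit. Conversely, a divisor of a
  monomial is a scalar times a monomial, and reducedness forces the exponent of a common one to be
  0.\<close>

lemma no_common_factor_monomials:
  "no_common_factor (\<lambda>i. monomial (A i) :: 'k::field poly3) \<longleftrightarrow> reduced A"
proof
  assume *: "no_common_factor (\<lambda>i. monomial (A i) :: 'k poly3)"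
  show "reduced A"
    unfolding reduced_def
  proof (rule ccontr)
    assume "\<not> (\<forall>j. \<exists>i. Poly_Mapping.lookup (A i) j = 0)"
    then obtain j where j: "\<And>i. Poly_Mapping.lookup (A i) j > 0"
      by auto
    have "A i = Poly_Mapping.single j 1 + (A i - Poly_Mapping.single j 1)" for i
      using j[of i]
      by (intro poly_mapping_eqI) (auto simp: lookup_add minus_poly_mapping.rep_eq lookup_single when_def)
    then have "var j dvd (monomial (A i) :: 'k poly3)" for i
      unfolding var_def by (metis dvd_triv_left mult_1 mult_single)
    then have "var j dvd (1 :: 'k poly3)"
      using * unfolding no_common_factor_def by blast
    then obtain q :: "'k poly3" where q: "var j * q = Poly_Mapping.single 0 1"
      by (auto elim: dvdE)
    obtain k l e where kl: "(var j :: 'k poly3) = Poly_Mapping.single k e" "k + l = 0"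
      using q by (rule divisor_of_single) auto
    have "Poly_Mapping.keys (var j :: 'k poly3) = {Poly_Mapping.single j 1}"
      by (simp add: var_def)
    then have "k = Poly_Mapping.single j 1"
      using kl(1) by (simp split: if_splits)
    then show False
      using kl(2) by (auto dest!: arg_cong[of _ _ "\<lambda>p. Poly_Mapping.lookup p j"] simp: lookup_add)
  qed
next
  assume red: "reduced A"
  show "no_common_factor (\<lambda>i. monomial (A i) :: 'k poly3)"
    unfolding no_common_factor_def
  proof (intro allI impI)
    fix h :: "'k poly3"
    assume dvd: "\<forall>i. h dvd monomial (A i)"
    have ex: "\<exists>k l e. h = Poly_Mapping.single k e \<and> k + l = A i" for i
    proof -
      obtain q where "h * q = Poly_Mapping.single (A i) 1"
        using dvd by (metis dvdE)
      then show ?thesis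
        by (rule divisor_of_single) auto
    qed
    then obtain k e where h: "h = Poly_Mapping.single k e"
      by blast
    have "h \<noteq> 0"
      using dvd by (metis dvd_0_left_iff keys_eq_empty keys_single insert_not_empty one_neq_zero)
    then have e: "e \<noteq> 0"
      using h by auto
    \<comment> \<open>\<open>ex\<close> may yield a different exponent for each \<open>i\<close>; as
      \<open>h\<close> is non-zero, its exponent is unique.\<close>
    have le: "\<exists>l. k + l = A i" for i
    proof -
      obtain k' l e' where *: "h = Poly_Mapping.single k' e'" "k' + l = A i"
        using ex by blast
      have "Poly_Mapping.keys h = {k}"
        using h e by simp
      then have "k' = k"
        using *(1) by (simp split: if_splits)
      then show ?thesis
        using *(2) by blast
    qed
    have "k = 0"
    proof (rule poly_mapping_eqI)
      fix j
      obtain i where "Poly_Mapping.lookup (A i) j = 0"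
        using red unfolding reduced_def by blast
      then show "Poly_Mapping.lookup k j = Poly_Mapping.lookup 0 j"
        using le[of i] by (metis add_is_0 lookup_add lookup_zero)
    qed
    then have "h * Poly_Mapping.single 0 (inverse e) = 1"
      using h e by (simp add: mult_single)
    then show "h dvd 1"
      by (metis dvd_triv_left)
  qed
qed

text \<open>In each column the difference of \<open>A\<close> and \<open>B\<close> is the same in
  all rows; since both columns have minimum 0, it is 0.\<close>

lemma reduced_unique:
  assumes "reduced A" "reduced B" "\<And>i j. A i + B j = A j + B i"
  shows "A i = B i"
proof (rule poly_mapping_eqI)
  fix j
  have eq: "Poly_Mapping.lookup (A i) j + Poly_Mapping.lookup (B l) j =
      Poly_Mapping.lookup (A l) j + Poly_Mapping.lookup (B i) j" for i l
    using assms(3) by (metis lookup_add)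
  obtain l m where "Poly_Mapping.lookup (A l) j = 0" "Poly_Mapping.lookup (B m) j = 0"
    using assms(1,2) unfolding reduced_def by blast
  then show "Poly_Mapping.lookup (A i) j = Poly_Mapping.lookup (B i) j"
    using eq[of l m] eq[of i l] by simp
qed

text \<open>The description in \<open>map_degree\<close> is unique because two reduced monomial
  tuples for the same map have equal exponents.\<close>

lemma map_degree_eq:
  fixes F :: "'k::field rat_map"
  assumes "\<And>i. mon_degree (A i) = d" "defines_map (\<lambda>i. monomial (A i)) F" "reduced A"
  shows "map_degree F = d"
  unfolding map_degree_def
proof (rule the_equality)
  show "\<exists>f. monomial_tuple d f \<and> defines_map f F \<and> no_common_factor f"
    using assms no_common_factor_monomials unfolding monomial_tuple_def
    by (intro exI[of _ "\<lambda>i. monomial (A i)"]) blast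
next
  fix d'
  assume "\<exists>f. monomial_tuple d' f \<and> defines_map f F \<and> no_common_factor f"
  then obtain f where f: "monomial_tuple d' f" "defines_map f F" "no_common_factor f"
    by blast
  obtain B where B: "\<And>i. mon_degree (B i) = d'" "\<And>i. f i = monomial (B i)"
    using f(1) unfolding monomial_tuple_def by metis
  have feq: "f = (\<lambda>i. monomial (B i))"
    using B by auto
  have "reduced B"
    using f(3) unfolding feq no_common_factor_monomials .
  moreover have "A i + B j = A j + B i" for i j
    using f(2) defines_map_iff_proportional[OF assms(2)] proportional_monomials
    unfolding feq by blast
  ultimately have "A i = B i" for i
    using reduced_unique[of A B] assms(3) by blast
  then show "d' = d"
    using assms(1) B(1) by metis
qed

lemma defines_map_reduced:
  fixes F :: "'k::field rat_map"
  assumes "\<And>i. mon_degree (A i) = d" "defines_map (\<lambda>i. monomial (A i)) F"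
  obtains R where "\<And>i. mon_degree (R i) = map_degree F" "defines_map (\<lambda>i. monomial (R i)) F" "reduced R"
proof -
  obtain R m where R: "reduced R" "\<And>i. A i = R i + m"
    using reduced_part by blast
  have deg: "mon_degree (R i) = d - mon_degree m" for i
    using assms(1)[of i] by (simp add: R(2) mon_degree_add)
  have "proportional (\<lambda>i. monomial (A i) :: 'k poly3) (\<lambda>i. monomial (R i))"
    unfolding proportional_monomials by (simp add: R(2) ac_simps)
  then have "defines_map (\<lambda>i. monomial (R i)) F"
    using defines_map_iff_proportional[OF assms(2)] form_tuple_monomials deg by blast
  then show ?thesis
    using that R(1) deg map_degree_eq by metis
qed

section \<open>The degree and the inverse in terms of exponent differences\<close>

text \<open>The entry in row 3 equals its excess over the column minimum, which is 0; the excess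
  depends on differences of rows only. In the type \<open>3\<close> the index 3 is 0.\<close>

lemma reduced_column:
  assumes "reduced R"
  shows "int (Poly_Mapping.lookup (R 3) j) =
    max 0 (max (- (int (Poly_Mapping.lookup (R 1) j) - int (Poly_Mapping.lookup (R 3) j)))
      (- (int (Poly_Mapping.lookup (R 2) j) - int (Poly_Mapping.lookup (R 3) j))))"
proof -
  obtain i where "Poly_Mapping.lookup (R i) j = 0"
    using assms unfolding reduced_def by blast
  then have "Poly_Mapping.lookup (R 1) j = 0 \<or> Poly_Mapping.lookup (R 2) j = 0 \<or>
      Poly_Mapping.lookup (R 3) j = 0"
    using exhaust_3[of i] by metis
  then show ?thesis
    by linarith
qed

text \<open>The degree is the sum of row 3. All rows have the same degree, so each row of
  \<open>x\<close> sums to 0, and this eliminates column 3.\<close>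

lemma reduced_degree:
  fixes R :: "3 \<Rightarrow> mon3"
  defines "x \<equiv> \<lambda>i j. int (Poly_Mapping.lookup (R i) j) - int (Poly_Mapping.lookup (R 3) j)"
  assumes "reduced R" "\<And>i. mon_degree (R i) = d"
  shows "int d = max 0 (max (x 1 1 + x 1 2) (x 2 1 + x 2 2)) +
    max 0 (max (- x 1 1) (- x 2 1)) + max 0 (max (- x 1 2) (- x 2 2))"
proof -
  have row: "- x i 3 = x i 1 + x i 2" for i
    using assms(3)[of i] assms(3)[of 3] by (simp add: x_def mon_degree_def sum_3)
  have column: "int (Poly_Mapping.lookup (R 3) j) = max 0 (max (- x 1 j) (- x 2 j))" for j
    unfolding x_def by (rule reduced_column[OF assms(2)])
  have "int d = int (Poly_Mapping.lookup (R 3) 3) + int (Poly_Mapping.lookup (R 3) 1)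
      + int (Poly_Mapping.lookup (R 3) 2)"
    using assms(3)[of 3] by (simp add: mon_degree_def sum_3)
  then show ?thesis
    by (simp only: column row)
qed

lemma degree_of_inverse_matrix:
  fixes a b c d a' b' c' d' :: int
  assumes "a' * a + b' * c = 1" "a' * b + b' * d = 0" "c' * a + d' * c = 0" "c' * b + d' * d = 1"
  shows "max 0 (max (a' + b') (c' + d')) + max 0 (max (- a') (- c')) + max 0 (max (- b') (- d')) =
    max 0 (max (a + b) (c + d)) + max 0 (max (- a) (- c)) + max 0 (max (- b) (- d))"
proof -
  let ?D = "a * d - b * c"
  have "(a' * d' - b' * c') * ?D =
      (a' * a + b' * c) * (c' * b + d' * d) - (a' * b + b' * d) * (c' * a + d' * c)"
    by (simp add: algebra_simps)
  then have "(a' * d' - b' * c') * ?D = 1"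
    by (simp add: assms)
  then have D: "?D = 1 \<or> ?D = - 1"
    using zmult_eq_1_iff by blast
  \<comment> \<open>Cramer's rule: the inverse times the determinant is the adjugate.\<close>
  have "a' * ?D = (a' * a + b' * c) * d - (a' * b + b' * d) * c"
    "b' * ?D = (a' * b + b' * d) * a - (a' * a + b' * c) * b"
    "c' * ?D = (c' * a + d' * c) * d - (c' * b + d' * d) * c"
    "d' * ?D = (c' * b + d' * d) * a - (c' * a + d' * c) * b"
    by (simp_all add: algebra_simps)
  then have inv: "a' * ?D = d" "b' * ?D = - b" "c' * ?D = - c" "d' * ?D = a"
    by (simp_all add: assms)
  from D show ?thesis
  proof
    assume "?D = 1"
    moreover from this have "a' = d" "b' = - b" "c' = - c" "d' = a"
      using inv by simp_all
    ultimately show ?thesis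
      using mixed_volume_symmetric[of a d b c]
      by (simp only: minus_minus add_uminus_conv_diff uminus_add_conv_diff)
  next
    assume "?D = - 1"
    moreover from this have "a' = - d" "b' = b" "c' = c" "d' = - a"
      using inv by simp_all
    \<comment> \<open>Swapping the rows turns the determinant into 1 and swaps the columns of the
      inverse. The degree expression is symmetric in rows and in columns, so neither swap changes
      it.\<close>
    moreover have "c * b - d * a > 0"
      using \<open>?D = - 1\<close> by (simp add: mult.commute)
    note mixed_volume_symmetric[OF this]
    ultimately show ?thesis
      by (simp only: minus_minus add_uminus_conv_diff uminus_add_conv_diff add.assoc
          max.commute add.commute add.left_commute)
  qed
qed

text \<open>For \<open>i\<close> and \<open>j\<close> among 1 and 2 this is the matrix identity
  \<open>y x = 1\<close>. Substitution multiplies exponent matrices, and as the rows of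
  \<open>y\<close> sum to 0, subtracting the row \<open>A 3\<close> from every row of
  \<open>A\<close> does not affect the product.\<close>

lemma inverse_exponent_matrix:
  fixes A B :: "3 \<Rightarrow> mon3"
  defines "x \<equiv> \<lambda>i j. int (Poly_Mapping.lookup (A i) j) - int (Poly_Mapping.lookup (A 3) j)"
    and "y \<equiv> \<lambda>i j. int (Poly_Mapping.lookup (B i) j) - int (Poly_Mapping.lookup (B 3) j)"
  assumes "\<And>i. mon_degree (B i) = e"
    and "\<And>i j. mon_subst (B i) A + Poly_Mapping.single j 1 = mon_subst (B j) A + Poly_Mapping.single i 1"
  shows "y i 1 * x 1 j + y i 2 * x 2 j = (1 when i = j) - (1 when j = 3)"
proof -
  have y3: "y i 3 = - (y i 1 + y i 2)"
    using assms(3)[of i] assms(3)[of 3] by (simp add: y_def mon_degree_def sum_3)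
  have "y i 1 * x 1 j + y i 2 * x 2 j = (\<Sum>l\<in>UNIV. y i l * int (Poly_Mapping.lookup (A l) j))"
    unfolding sum_3 y3 by (simp add: x_def algebra_simps)
  also have "\<dots> = int (Poly_Mapping.lookup (mon_subst (B i) A) j)
      - int (Poly_Mapping.lookup (mon_subst (B 3) A) j)"
    by (simp add: lookup_mon_subst y_def sum_subtractf left_diff_distrib)
  also have "\<dots> = (1 when i = j) - (1 when j = 3)"
    using arg_cong[OF assms(4)[of i 3], of "\<lambda>m. Poly_Mapping.lookup m j"]
    by (auto simp: lookup_add lookup_single when_def split: if_splits)
  finally show ?thesis .
qed

theorem proposition4p6:
  fixes F G :: "'k::field rat_map"
  assumes "cremona_monomial_map F"
    and "inverse_maps F G"
  shows "map_degree G = map_degree F"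
proof -
  obtain d f where f: "monomial_tuple d f" "defines_map f F"
    using assms(1) unfolding cremona_monomial_map_def by blast
  obtain A0 where A0: "\<And>i. mon_degree (A0 i) = d" "\<And>i. f i = monomial (A0 i)"
    using f(1) unfolding monomial_tuple_def by metis
  have "f = (\<lambda>i. monomial (A0 i))"
    by (rule ext) (rule A0(2))
  with f(2) have F: "defines_map (\<lambda>i. monomial (A0 i)) F"
    by (simp only:)
  obtain A where A: "\<And>i. mon_degree (A i) = map_degree F"
      "defines_map (\<lambda>i. monomial (A i)) F" "reduced A"
    by (rule defines_map_reduced[OF A0(1) F]) (rule that)
  \<comment> \<open>This tuple for the inverse may have a common factor, hence the second
    reduction.\<close>
  obtain B0 e where G: "\<And>i. mon_degree (B0 i) = e" "defines_map (\<lambda>i. monomial (B0 i)) G"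
    by (rule inverse_map_monomial[OF assms(2) A(2)]) (rule that)
  obtain B where B: "\<And>i. mon_degree (B i) = map_degree G"
      "defines_map (\<lambda>i. monomial (B i)) G" "reduced B"
    by (rule defines_map_reduced[OF G]) (rule that)
  have "is_composite G F id_map"
    using assms(2) by (simp add: inverse_maps_def)
  from composite_eq_id_map_proportional[OF this B(2) A(2)]
  have cross: "mon_subst (B i) A + Poly_Mapping.single j 1 =
      mon_subst (B j) A + Poly_Mapping.single i 1" for i j
    unfolding subst_monomials var_def proportional_monomials by blast
  note xy = inverse_exponent_matrix[OF B(1) cross]
  have "int (map_degree G) = int (map_degree F)"
    unfolding reduced_degree[OF A(3,1)] reduced_degree[OF B(3,1)]
  proof (rule degree_of_inverse_matrix)
  \<comment> \<open>The four equations are the entries of \<open>xy\<close> with both indices among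
    1 and 2.\<close>
  qed (rule trans[OF xy], simp)+
  then show ?thesis
    by simp
qed

end
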